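(* Let $G=(V,E)$ be a finite connected graph with $\mathrm{Ric}(G)\ge 0$. Then $\lambda\le 16h^2$, where $\lambda$ is the spectral gap of $G$ and $h$ its Cheeger constant.
   Context: Let $G=(V,E)$ be an undirected simple graph with no isolated vertices; write $y\sim x$ if $\{x,y\}\in E$. For $f,g:V\to\mathbb R$ define $\Delta f(x)=\sum_{y\sim x}(f(y)-f(x))$, $\Gamma(f,g)(x)=\frac12\sum_{y\sim x}(f(x)-f(y))(g(x)-g(y))$, $\Gamma(f)=\Gamma(f,f)$, and $\Gamma_2(f)=\frac12\Delta\Gamma(f)-\Gamma(f,\Delta f)$. "$\mathrm{Ric}(G)\ge K$" means $\Gamma_2(f)(x)\ge K\,\Gamma(f)(x)$ for all $f:V\to\mathbb R$ and all $x\in V$; $\mathrm{Ric}(G)$ is the largest such $K$. The spectral gap $\lambda$ is the least nonzero eigenvalue of $-\Delta$. The Cheeger constant is $h=\min_{0<|A|\le|V|/2}|\partial A|/|A|$, where $|\partial A|$ is the number of edges between $A$ and $V\setminus A$. *)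

theory Defs
  imports Complex_Main
begin

definition simple_graph :: "'a set \<Rightarrow> 'a set set \<Rightarrow> bool" where
  "simple_graph V E \<longleftrightarrow> (\<forall>e\<in>E. e \<subseteq> V \<and> card e = 2)"

definition no_isolated_vertices :: "'a set \<Rightarrow> 'a set set \<Rightarrow> bool" where
  "no_isolated_vertices V E \<longleftrightarrow> (\<forall>x\<in>V. \<exists>y\<in>V. {x, y} \<in> E)"

text \<open>The empty graph is not regarded as connected.\<close>

definition connected_graph :: "'a set \<Rightarrow> 'a set set \<Rightarrow> bool" where
  "connected_graph V E \<longleftrightarrow>
     V \<noteq> {} \<and> (\<forall>x\<in>V. \<forall>y\<in>V. (x, y) \<in> {(u, v). {u, v} \<in> E}\<^sup>*)"

text \<open>
  A function on the vertex set \<open>V\<close> is represented by a total function on the ambient type. In a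
  simple graph all neighbours of a vertex lie in \<open>V\<close>, so the operators below, evaluated at a
  vertex, depend only on the values of their arguments on \<open>V\<close>.
\<close>

definition laplacian :: "'a set set \<Rightarrow> ('a \<Rightarrow> real) \<Rightarrow> 'a \<Rightarrow> real" where
  "laplacian E f x = (\<Sum>y | {x, y} \<in> E. f y - f x)"

definition carre_du_champ :: "'a set set \<Rightarrow> ('a \<Rightarrow> real) \<Rightarrow> ('a \<Rightarrow> real) \<Rightarrow> 'a \<Rightarrow> real" where
  "carre_du_champ E f g x = 1 / 2 * (\<Sum>y | {x, y} \<in> E. (f x - f y) * (g x - g y))"

definition gamma2 :: "'a set set \<Rightarrow> ('a \<Rightarrow> real) \<Rightarrow> 'a \<Rightarrow> real" where
  "gamma2 E f x =
     1 / 2 * laplacian E (carre_du_champ E f f) x - carre_du_champ E f (laplacian E f) x"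

definition Ric_ge :: "'a set \<Rightarrow> 'a set set \<Rightarrow> real \<Rightarrow> bool" where
  "Ric_ge V E K \<longleftrightarrow> (\<forall>f. \<forall>x\<in>V. gamma2 E f x \<ge> K * carre_du_champ E f f x)"

definition neg_laplacian_eigenvalue :: "'a set \<Rightarrow> 'a set set \<Rightarrow> real \<Rightarrow> bool" where
  "neg_laplacian_eigenvalue V E \<mu> \<longleftrightarrow>
     (\<exists>f. (\<exists>x\<in>V. f x \<noteq> 0) \<and> (\<forall>x\<in>V. - laplacian E f x = \<mu> * f x))"

text \<open>
  The operator is symmetric, so all its eigenvalues are real. For a finite connected graph with
  at least two vertices a least nonzero eigenvalue exists.
\<close>

definition spectral_gap :: "'a set \<Rightarrow> 'a set set \<Rightarrow> real" where
  "spectral_gap V E = (LEAST \<mu>. neg_laplacian_eigenvalue V E \<mu> \<and> \<mu> \<noteq> 0)"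

definition edge_boundary :: "'a set \<Rightarrow> 'a set set \<Rightarrow> 'a set \<Rightarrow> 'a set set" where
  "edge_boundary V E A = {e \<in> E. \<exists>x\<in>A. \<exists>y\<in>V - A. e = {x, y}}"

definition cheeger_constant :: "'a set \<Rightarrow> 'a set set \<Rightarrow> real" where
  "cheeger_constant V E =
     Min ((\<lambda>A. real (card (edge_boundary V E A)) / real (card A)) `
       {A. A \<subseteq> V \<and> 0 < card A \<and> real (card A) \<le> real (card V) / 2})"

end

theory Submission
  imports Defs "HOL-Analysis.Function_Topology"
begin

text \<open>
  A Buser-type argument in which the heat semigroup is replaced by implicit Euler steps
  \<open>u\<^sub>n = (1 - t \<Delta>) u\<^bsub>n+1\<^esub>\<close>. Nonnegative curvature gives \<open>(1 - t \<Delta>) \<Gamma>(u\<^bsub>n+1\<^esub>) \<le> \<Gamma>(u\<^sub>n)\<close> with no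
  error term, and the maximum principle for \<open>1 - t \<Delta>\<close> turns this into the gradient bound
  \<open>2 t n \<Gamma>(u\<^bsub>n+1\<^esub>) \<le> 1\<close> when \<open>\<bar>u\<^sub>0\<bar> \<le> 1\<close>. Start from the centred indicator \<open>u\<^sub>0 = 1\<^sub>A - |A|/|V|\<close> and sum
  \<open>u\<^sub>0 - u\<^sub>N\<close> over \<open>A\<close>: by the gradient bound the sum is at most \<open>|\<partial>A| (t + \<surd>(t N))\<close>, while for
  \<open>N = 2 m\<close> it equals \<open>\<parallel>u\<^sub>0\<parallel>\<^sup>2 - \<parallel>u\<^sub>m\<parallel>\<^sup>2\<close>, which is at least \<open>|A| / 4\<close> as soon as \<open>2 t m \<lambda> = 1\<close>. Letting
  \<open>m\<close> tend to infinity yields \<open>\<surd>\<lambda> \<le> 4 |\<partial>A| / |A|\<close>.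
\<close>

text \<open>Makes the gradient bounds \<open>1 / sqrt k\<close> telescope when they are summed over
  the time steps.\<close>

lemma inverse_sqrt_le: "1 / sqrt (real (Suc n)) \<le> 2 * (sqrt (Suc n) - sqrt n)"
proof -
  let ?a = "sqrt (Suc n)" and ?b = "sqrt n"
  have a: "?a > 0" and ab: "?b \<le> ?a" by simp_all
  have "1 = ?a * ?a - ?b * ?b" by simp
  also have "\<dots> = (?a - ?b) * (?a + ?b)" by (simp add: algebra_simps)
  also have "\<dots> \<le> (?a - ?b) * (2 * ?a)" using ab by (intro mult_left_mono) auto
  finally show ?thesis using a by (simp add: field_simps)
qed

section \<open>Calculus with \<Delta> and \<Gamma> on a finite graph\<close>

locale finite_simple_graph =
  fixes V :: "'a set" and E :: "'a set set"
  assumes finite_V: "finite V" and simple: "simple_graph V E"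
begin

lemma edge_vertices:
  assumes "{x, y} \<in> E"
  shows "x \<in> V" "y \<in> V" "x \<noteq> y"
proof -
  have "{x, y} \<subseteq> V" "card {x, y} = 2"
    using simple assms unfolding simple_graph_def by blast+
  then show "x \<in> V" "y \<in> V" "x \<noteq> y" by auto
qed

lemma finite_neighbours: "finite {y. {x, y} \<in> E}"
  using edge_vertices(2) by (intro finite_subset[OF _ finite_V]) auto

text \<open>Adjacency is symmetric, so endpoints may be exchanged. \<open>A = V\<close> serves
  Green's formula; a general \<open>A\<close> lets the inner edges of \<open>A\<close>
  cancel.\<close>

lemma sum_edges_swap:
  assumes "A \<subseteq> V"
  shows "(\<Sum>x\<in>A. \<Sum>y\<in>{y\<in>A. {x, y} \<in> E}. F x y) = (\<Sum>x\<in>A. \<Sum>y\<in>{y\<in>A. {x, y} \<in> E}. F y x)"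
proof -
  have fin: "finite A" using assms finite_V by (rule finite_subset)
  show ?thesis
    using sum.swap_restrict[OF fin fin, of F "\<lambda>x y. {x, y} \<in> E"]
    by (simp add: insert_commute)
qed

lemma neighbours_eq: "{y. {x, y} \<in> E} = {y\<in>V. {x, y} \<in> E}"
  using edge_vertices(2) by blast

text \<open>Exchanging endpoints shows that \<open>f x * (g y - g x)\<close> and
  \<open>f y * (g x - g y)\<close> have equal sums; the symmetric product is minus their
  total.\<close>

lemma green_formula:
  "(\<Sum>x\<in>V. f x * laplacian E g x) =
    - (1 / 2) * (\<Sum>x\<in>V. \<Sum>y | {x, y} \<in> E. (f x - f y) * (g x - g y))"
proof -
  have "(\<Sum>x\<in>V. \<Sum>y | {x, y} \<in> E. f x * (g y - g x)) =
      (\<Sum>x\<in>V. \<Sum>y | {x, y} \<in> E. f y * (g x - g y))"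
    using sum_edges_swap[OF order_refl, of "\<lambda>x y. f x * (g y - g x)"]
    by (simp add: neighbours_eq)
  moreover have "(\<Sum>x\<in>V. \<Sum>y | {x, y} \<in> E. (f x - f y) * (g x - g y)) =
      - (\<Sum>x\<in>V. \<Sum>y | {x, y} \<in> E. f x * (g y - g x))
      - (\<Sum>x\<in>V. \<Sum>y | {x, y} \<in> E. f y * (g x - g y))"
    by (simp add: sum_negf[symmetric] sum_subtractf[symmetric] algebra_simps)
  ultimately show ?thesis
    by (simp add: laplacian_def sum_distrib_left)
qed

lemma laplacian_symmetric:
  "(\<Sum>x\<in>V. f x * laplacian E g x) = (\<Sum>x\<in>V. g x * laplacian E f x)"
  by (simp add: green_formula mult.commute)

lemma sum_laplacian: "(\<Sum>x\<in>V. laplacian E f x) = 0"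
  using green_formula[of "\<lambda>_. 1" f] by simp

lemma laplacian_cong:
  assumes "x \<in> V" "\<And>y. y \<in> V \<Longrightarrow> f y = g y"
  shows "laplacian E f x = laplacian E g x"
  unfolding laplacian_def using assms edge_vertices(2) by (intro sum.cong) auto

lemma carre_du_champ_cong:
  assumes "x \<in> V" "\<And>y. y \<in> V \<Longrightarrow> f y = g y"
  shows "carre_du_champ E f f x = carre_du_champ E g g x"
  unfolding carre_du_champ_def using assms edge_vertices(2)
  by (intro arg_cong2[where f="(*)"] sum.cong) auto

lemma laplacian_affine: "laplacian E (\<lambda>x. a * f x + b) x = a * laplacian E f x"
  by (simp add: laplacian_def sum_distrib_left algebra_simps)

lemma laplacian_add_scaled:
  "laplacian E (\<lambda>x. f x + c * g x) x = laplacian E f x + c * laplacian E g x"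
  unfolding laplacian_def sum_distrib_left sum.distrib[symmetric]
  by (intro sum.cong refl) (simp add: algebra_simps)

text \<open>Sum of \<open>b\<^sup>2 - a\<^sup>2 = 2 * a * (b - a) + (b - a)\<^sup>2\<close> over the
  neighbours, with \<open>a = f x\<close>. The \<Gamma> term later pays for raising the gradient
  coefficient from \<open>n\<close> to \<open>Suc n\<close>.\<close>

lemma laplacian_square:
  "laplacian E (\<lambda>y. (f y)\<^sup>2) x = 2 * f x * laplacian E f x + 2 * carre_du_champ E f f x"
  by (simp add: laplacian_def carre_du_champ_def sum_distrib_left sum.distrib[symmetric]
      power2_eq_square algebra_simps)

lemma carre_du_champ_nonneg: "carre_du_champ E f f x \<ge> 0"
  unfolding carre_du_champ_def by (simp add: sum_nonneg)

lemma carre_du_champ_diff: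
  "carre_du_champ E (\<lambda>y. f y - t * g y) (\<lambda>y. f y - t * g y) x =
    carre_du_champ E f f x - 2 * t * carre_du_champ E f g x + t\<^sup>2 * carre_du_champ E g g x"
  unfolding carre_du_champ_def sum_distrib_left sum.distrib[symmetric] sum_subtractf[symmetric]
  by (intro sum.cong refl) (simp add: power2_eq_square algebra_simps)

lemma edge_difference_le_carre_du_champ:
  assumes "{x, y} \<in> E"
  shows "(f x - f y)\<^sup>2 \<le> 2 * carre_du_champ E f f x"
proof -
  have "(f x - f y)\<^sup>2 \<le> (\<Sum>y | {x, y} \<in> E. (f x - f y)\<^sup>2)"
    using assms by (intro member_le_sum) (auto simp: finite_neighbours)
  then show ?thesis by (simp add: carre_du_champ_def power2_eq_square)
qed

section \<open>Maximum principle and the resolvent of \<Delta>\<close>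

text \<open>At a minimum point \<open>z\<close> of \<open>v\<close> on \<open>V\<close> every
  summand of the Laplacian is nonnegative, so
  \<open>0 \<le> t * laplacian E v z \<le> v z\<close>.\<close>

lemma resolvent_nonneg:
  assumes "t \<ge> 0" and nonneg: "\<And>x. x \<in> V \<Longrightarrow> 0 \<le> v x - t * laplacian E v x" and "x \<in> V"
  shows "0 \<le> v x"
proof -
  obtain z where z: "z \<in> V" "\<And>y. y \<in> V \<Longrightarrow> v z \<le> v y"
    using finite_V \<open>x \<in> V\<close> arg_min_if_finite[of V v]
    by (metis empty_iff linorder_not_less)
  have "0 \<le> laplacian E v z"
    unfolding laplacian_def using z(2) edge_vertices(2) by (intro sum_nonneg) auto
  then have "0 \<le> t * laplacian E v z" using \<open>t \<ge> 0\<close> by simp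
  with nonneg[OF z(1)] have "0 \<le> v z" by linarith
  with z(2)[OF \<open>x \<in> V\<close>] show ?thesis by linarith
qed

lemma resolvent_mono:
  assumes "t \<ge> 0" and "x \<in> V"
    and "\<And>x. x \<in> V \<Longrightarrow> u x - t * laplacian E u x \<le> v x - t * laplacian E v x"
  shows "u x \<le> v x"
proof -
  have "laplacian E (\<lambda>x. v x - u x) y = laplacian E v y - laplacian E u y" for y
    using laplacian_add_scaled[of v "-1" u] by simp
  then have diff: "(v y - u y) - t * laplacian E (\<lambda>x. v x - u x) y =
      (v y - t * laplacian E v y) - (u y - t * laplacian E u y)" for y
    by (simp add: right_diff_distrib)
  have "0 \<le> v x - u x"
  proof (rule resolvent_nonneg[OF \<open>t \<ge> 0\<close> _ \<open>x \<in> V\<close>])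
    fix y assume "y \<in> V"
    then show "0 \<le> (v y - u y) - t * laplacian E (\<lambda>x. v x - u x) y"
      unfolding diff using assms(3) by simp
  qed
  then show ?thesis by simp
qed

text \<open>With \<open>D\<close> a bound on the degrees, \<open>\<Delta> = D (T - 1)\<close> for a Markov operator \<open>T\<close>, and the
  resolvent \<open>(1 - t \<Delta>)\<inverse>\<close> is the Neumann series \<open>(1 - q) \<Sum>k. q ^ k T ^ k\<close> with \<open>q = t D / (1 + t D)\<close>.\<close>

lemma resolvent_exists:
  assumes "t \<ge> 0"
  shows "\<exists>v. \<forall>x\<in>V. v x - t * laplacian E v x = f x"
proof -
  \<comment> \<open>Degrees are at most \<open>card V\<close>; the \<open>+ 1\<close> keeps
    \<open>D\<close> positive even for empty \<open>V\<close>.\<close>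
  define D where "D = real (card V) + 1"
  define T where "T = (\<lambda>g x. g x + laplacian E g x / D)"
  define q where "q = t * D / (1 + t * D)"
  have D: "D > 0" by (simp add: D_def)
  have tD: "0 \<le> t * D" using assms D by simp
  then have q: "0 \<le> q" "q < 1" by (simp_all add: q_def divide_simps)
  define B where "B = (\<Sum>x\<in>V. \<bar>f x\<bar>)"
  have bound: "\<bar>(T ^^ k) f x\<bar> \<le> B" if "x \<in> V" for k x
    using that
  proof (induction k arbitrary: x)
    case 0
    then show ?case unfolding B_def using finite_V by (auto intro: member_le_sum)
  next
    case (Suc k)
    let ?g = "(T ^^ k) f"
    let ?N = "{y. {x, y} \<in> E}"
    have card: "real (card ?N) \<le> D"
      unfolding D_def using card_mono[OF finite_V, of ?N] edge_vertices(2) by fastforce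
    \<comment> \<open>\<open>T\<close> averages: the weight \<open>D - card ?N\<close> at
      \<open>x\<close> is nonnegative and all weights sum to \<open>D\<close>, so the bound
      \<open>B\<close> survives each application.\<close>
    have "D * (T ^^ Suc k) f x = (D - real (card ?N)) * ?g x + (\<Sum>y\<in>?N. ?g y)"
      using D by (simp add: T_def laplacian_def sum_subtractf field_simps)
    also have "\<bar>\<dots>\<bar> \<le> (D - real (card ?N)) * \<bar>?g x\<bar> + (\<Sum>y\<in>?N. \<bar>?g y\<bar>)"
      using card by (intro order_trans[OF abs_triangle_ineq] add_mono sum_abs) (simp add: abs_mult)
    also have "\<dots> \<le> (D - real (card ?N)) * B + (\<Sum>y\<in>?N. B)"
      using card Suc edge_vertices(2) by (intro add_mono mult_left_mono sum_mono) auto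
    also have "\<dots> = D * B" by (simp add: algebra_simps)
    finally show ?case using D by (simp add: abs_mult)
  qed
  have summ: "summable (\<lambda>k. q ^ k * (T ^^ k) f x)" if "x \<in> V" for x
  proof (rule summable_comparison_test)
    show "\<exists>N. \<forall>n\<ge>N. norm (q ^ n * (T ^^ n) f x) \<le> q ^ n * B"
      using bound[OF that] q by (auto simp: abs_mult intro!: mult_left_mono)
    show "summable (\<lambda>n. q ^ n * B)"
      using q by (intro summable_mult2 summable_geometric) auto
  qed
  define S where "S = (\<lambda>x. \<Sum>k. q ^ k * (T ^^ k) f x)"
  \<comment> \<open>Applying \<open>q T\<close> termwise shifts the index of the series by one, so
    only the term \<open>k = 0\<close> is left.\<close>
  have T_S: "S x - q * T S x = f x" if x: "x \<in> V" for x
  proof -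
    have "laplacian E S x = (\<Sum>k. \<Sum>y | {x, y} \<in> E. q ^ k * (T ^^ k) f y - q ^ k * (T ^^ k) f x)"
      unfolding laplacian_def S_def using summ x edge_vertices(2)
      by (subst suminf_sum) (auto intro!: sum.cong summable_diff suminf_diff)
    also have "\<dots> = (\<Sum>k. q ^ k * laplacian E ((T ^^ k) f) x)"
      by (simp add: laplacian_def sum_distrib_left right_diff_distrib)
    finally have lap: "laplacian E S x = (\<Sum>k. q ^ k * laplacian E ((T ^^ k) f) x)" .
    have summ_lap: "summable (\<lambda>k. q ^ k * laplacian E ((T ^^ k) f) x)"
      unfolding laplacian_def sum_distrib_left right_diff_distrib using summ x edge_vertices(2)
      by (intro summable_sum summable_diff) auto
    have "T S x = (\<Sum>k. q ^ k * (T ^^ k) f x) + (\<Sum>k. q ^ k * laplacian E ((T ^^ k) f) x / D)"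
      using suminf_divide[OF summ_lap, of D] unfolding T_def lap by (simp add: S_def T_def)
    also have "\<dots> = (\<Sum>k. q ^ k * (T ^^ k) f x + q ^ k * laplacian E ((T ^^ k) f) x / D)"
      using summ[OF x] summ_lap by (intro suminf_add summable_divide)
    also have "\<dots> = (\<Sum>k. q ^ k * (T ^^ Suc k) f x)"
      by (simp add: T_def algebra_simps)
    finally have TS: "T S x = (\<Sum>k. q ^ k * (T ^^ Suc k) f x)" .
    have summ_T: "summable (\<lambda>k. q ^ k * (T ^^ Suc k) f x)"
      using summable_add[OF summ[OF x] summable_divide[OF summ_lap, of D]]
      by (simp add: T_def algebra_simps)
    have "S x = (\<Sum>k. q ^ Suc k * (T ^^ Suc k) f x) + f x"
      unfolding S_def using suminf_split_head[OF summ[OF x]] by simp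
    also have "(\<Sum>k. q ^ Suc k * (T ^^ Suc k) f x) = q * T S x"
      using suminf_mult[OF summ_T, of q] by (simp add: TS mult.assoc)
    finally show ?thesis by simp
  qed
  define v where "v = (\<lambda>x. (1 - q) * S x + 0)"
  have "v x - t * laplacian E v x = f x" if "x \<in> V" for x
  proof -
    have "v x - t * laplacian E v x = (1 - q) * (S x - t * laplacian E S x)"
      unfolding v_def laplacian_affine by (simp add: algebra_simps)
    \<comment> \<open>Since \<open>T = 1 + \<Delta> / D\<close>, the operators
      \<open>(1 - q) (1 - t \<Delta>)\<close> and \<open>1 - q T\<close> coincide.\<close>
    also have "1 - q = 1 / (1 + t * D)" using tD by (simp add: q_def field_simps)
    also have "1 / (1 + t * D) * (S x - t * laplacian E S x) = S x - q * T S x"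
    proof -
      have "q * T S x = t * (D * T S x) / (1 + t * D)" by (simp add: q_def)
      also have "D * T S x = D * S x + laplacian E S x" using D by (simp add: T_def field_simps)
      finally show ?thesis using tD by (simp add: field_simps)
    qed
    finally show ?thesis using T_S[OF that] by simp
  qed
  then show ?thesis by blast
qed

lemma resolvent_sequence_exists:
  assumes "t \<ge> 0"
  obtains u where "u 0 = f" "\<And>n x. x \<in> V \<Longrightarrow> u (Suc n) x - t * laplacian E (u (Suc n)) x = u n x"
proof -
  define R where "R = (\<lambda>g. SOME v. \<forall>x\<in>V. v x - t * laplacian E v x = g x)"
  have R: "\<forall>x\<in>V. R g x - t * laplacian E (R g) x = g x" for g
    unfolding R_def by (rule someI_ex[OF resolvent_exists[OF assms]])
  show ?thesis
    by (rule that[of "\<lambda>n. (R ^^ n) f"]) (use R in auto)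
qed

section \<open>Curvature and gradient bounds along the Euler steps\<close>

text \<open>Expand \<Gamma> of \<open>v - t \<Delta> v\<close>. The cross term equals
  \<open>2 t \<Gamma>\<^sub>2(v) - t \<Delta> \<Gamma>(v)\<close>; the curvature hypothesis makes
  its first part nonnegative, and the quadratic term \<open>t\<^sup>2 \<Gamma>(\<Delta> v)\<close>
  is nonnegative as well.\<close>

lemma resolvent_carre_du_champ_le:
  assumes "Ric_ge V E 0" and "t \<ge> 0" and x: "x \<in> V"
    and v: "\<And>x. x \<in> V \<Longrightarrow> v x - t * laplacian E v x = u x"
  shows "carre_du_champ E v v x - t * laplacian E (carre_du_champ E v v) x \<le> carre_du_champ E u u x"
proof -
  have "carre_du_champ E u u x =
      carre_du_champ E (\<lambda>y. v y - t * laplacian E v y) (\<lambda>y. v y - t * laplacian E v y) x"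
    using v x by (intro carre_du_champ_cong) auto
  also have "\<dots> = carre_du_champ E v v x - 2 * t * carre_du_champ E v (laplacian E v) x
      + t\<^sup>2 * carre_du_champ E (laplacian E v) (laplacian E v) x"
    by (rule carre_du_champ_diff)
  finally have eq: "carre_du_champ E u u x = \<dots>" .
  have "0 \<le> gamma2 E v x" using assms(1) x unfolding Ric_ge_def by fastforce
  then have "0 \<le> t * (2 * gamma2 E v x)" using \<open>t \<ge> 0\<close> by simp
  moreover have "0 \<le> t\<^sup>2 * carre_du_champ E (laplacian E v) (laplacian E v) x"
    by (simp add: carre_du_champ_nonneg)
  ultimately show ?thesis unfolding eq by (simp add: gamma2_def algebra_simps)
qed

text \<open>Using the resolvent \<open>z\<close> of \<open>\<Gamma>(u\<^sub>n)\<close> instead of \<open>\<Gamma>(u\<^sub>n)\<close> itself is what lets the induction close: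
  applying \<open>1 - t \<Delta>\<close> to the left-hand side for \<open>n + 1\<close> gives at most the left-hand side for \<open>n\<close>.\<close>

lemma resolvent_sequence_bound:
  assumes Ric: "Ric_ge V E 0" and t: "t \<ge> 0"
    and u: "\<And>n x. x \<in> V \<Longrightarrow> u (Suc n) x - t * laplacian E (u (Suc n)) x = u n x"
    and u0: "\<And>x. x \<in> V \<Longrightarrow> (u 0 x)\<^sup>2 \<le> 1"
    and z: "\<And>x. x \<in> V \<Longrightarrow> z x - t * laplacian E z x = carre_du_champ E (u n) (u n) x"
    and "x \<in> V"
  shows "(u n x)\<^sup>2 + 2 * t * n * z x \<le> 1"
  using z \<open>x \<in> V\<close>
proof (induction n arbitrary: z x)
  case 0
  then show ?case using u0 by simp
next
  case (Suc n)
  let ?G = "\<lambda>n. carre_du_champ E (u n) (u n)"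
  obtain z' where z': "\<And>x. x \<in> V \<Longrightarrow> z' x - t * laplacian E z' x = ?G n x"
    using resolvent_exists[OF t, of "?G n"] by blast
  have G_le: "?G (Suc n) y \<le> z' y" if "y \<in> V" for y
  proof (rule resolvent_mono[OF t that])
    fix x assume x: "x \<in> V"
    show "?G (Suc n) x - t * laplacian E (?G (Suc n)) x \<le> z' x - t * laplacian E z' x"
      unfolding z'[OF x] by (rule resolvent_carre_du_champ_le[OF Ric t x u])
  qed
  show ?case
  proof (rule resolvent_mono[OF t Suc.prems(2), where v = "\<lambda>_. 1"])
    fix y assume y: "y \<in> V"
    have "laplacian E (\<lambda>x. (u (Suc n) x)\<^sup>2 + 2 * t * real (Suc n) * z x) y =
        2 * u (Suc n) y * laplacian E (u (Suc n)) y + 2 * ?G (Suc n) y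
        + 2 * t * real (Suc n) * laplacian E z y"
      by (simp only: laplacian_add_scaled laplacian_square)
    \<comment> \<open>Completing the square: with \<open>w = t * laplacian E (u (Suc n)) y\<close>,
      the part \<open>u\<^sup>2 - 2 * u * w\<close> is \<open>(u - w)\<^sup>2 - w\<^sup>2\<close>,
      and \<open>u - w\<close> is the previous iterate.\<close>
    then have "(u (Suc n) y)\<^sup>2 + 2 * t * real (Suc n) * z y
        - t * laplacian E (\<lambda>x. (u (Suc n) x)\<^sup>2 + 2 * t * real (Suc n) * z x) y =
        (u (Suc n) y - t * laplacian E (u (Suc n)) y)\<^sup>2 - (t * laplacian E (u (Suc n)) y)\<^sup>2
        + 2 * t * real (Suc n) * (z y - t * laplacian E z y) - 2 * t * ?G (Suc n) y"
      by (simp only:) (simp add: power2_eq_square algebra_simps)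
    \<comment> \<open>\<open>z\<close> solves the resolvent equation for \<Gamma> at
      \<open>Suc n\<close>, so the coefficient of that \<Gamma> is
      \<open>2 * t * Suc n - 2 * t\<close>.\<close>
    also have "\<dots> = (u n y)\<^sup>2 - (t * laplacian E (u (Suc n)) y)\<^sup>2 + 2 * t * n * ?G (Suc n) y"
      using u[OF y, of n] Suc.prems(1)[OF y] by (simp add: algebra_simps)
    also have "\<dots> \<le> (u n y)\<^sup>2 + 2 * t * n * z' y"
      using G_le[OF y] t by (intro add_mono mult_left_mono) auto
    also have "\<dots> \<le> 1" using Suc.IH[OF z' y] by simp
    finally show "(u (Suc n) y)\<^sup>2 + 2 * t * real (Suc n) * z y
        - t * laplacian E (\<lambda>x. (u (Suc n) x)\<^sup>2 + 2 * t * real (Suc n) * z x) y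
        \<le> 1 - t * laplacian E (\<lambda>_. 1) y"
      by (simp add: laplacian_def)
  qed
qed

text \<open>The previous bound concerns the resolvent of \<Gamma> at step \<open>n\<close>; by
  curvature this dominates \<Gamma> at step \<open>Suc n\<close>, which explains the index shift. At
  step 1 only the sup bound on the values is available.\<close>

lemma resolvent_sequence_gradient:
  assumes Ric: "Ric_ge V E 0" and t: "t > 0"
    and u: "\<And>n x. x \<in> V \<Longrightarrow> u (Suc n) x - t * laplacian E (u (Suc n)) x = u n x"
    and u0: "\<And>x. x \<in> V \<Longrightarrow> (u 0 x)\<^sup>2 \<le> 1"
    and e: "{x, y} \<in> E"
  shows "\<bar>u (Suc 0) x - u (Suc 0) y\<bar> \<le> 2"
    and "n > 0 \<Longrightarrow> \<bar>u (Suc n) x - u (Suc n) y\<bar> \<le> 1 / sqrt (t * n)"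
proof -
  let ?G = "\<lambda>n. carre_du_champ E (u n) (u n)"
  have t0: "t \<ge> 0" using t by simp
  have bound: "(u n x)\<^sup>2 \<le> 1 \<and> 2 * t * n * ?G (Suc n) x \<le> 1" if x: "x \<in> V" for n x
  proof -
    obtain z where z: "\<And>x. x \<in> V \<Longrightarrow> z x - t * laplacian E z x = ?G n x"
      using resolvent_exists[OF t0, of "?G n"] by blast
    have G_le: "?G (Suc n) x \<le> z x"
    proof (rule resolvent_mono[OF t0 x])
      fix y assume y: "y \<in> V"
      show "?G (Suc n) y - t * laplacian E (?G (Suc n)) y \<le> z y - t * laplacian E z y"
        unfolding z[OF y] by (rule resolvent_carre_du_champ_le[OF Ric t0 y u])
    qed
    have b: "(u n x)\<^sup>2 + 2 * t * n * z x \<le> 1"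
      by (rule resolvent_sequence_bound[OF Ric t0 u u0 z x])
    have "0 \<le> 2 * t * n * ?G (Suc n) x" using t by (simp add: carre_du_champ_nonneg)
    moreover have "2 * t * n * ?G (Suc n) x \<le> 2 * t * n * z x"
      using G_le t by (intro mult_left_mono) auto
    moreover have "0 \<le> (u n x)\<^sup>2" by simp
    ultimately show ?thesis using b by linarith
  qed
  have "\<bar>u (Suc 0) x\<bar> \<le> 1" "\<bar>u (Suc 0) y\<bar> \<le> 1"
    using bound edge_vertices[OF e] by (simp_all add: abs_square_le_1)
  then show "\<bar>u (Suc 0) x - u (Suc 0) y\<bar> \<le> 2" by linarith
  assume "n > 0"
  then have tn: "t * n > 0" using t by simp
  have "(u (Suc n) x - u (Suc n) y)\<^sup>2 \<le> 2 * ?G (Suc n) x"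
    by (rule edge_difference_le_carre_du_champ[OF e])
  also have "\<dots> \<le> 1 / (t * n)"
    using bound[OF edge_vertices(1)[OF e], of n] tn by (simp add: field_simps)
  finally have "sqrt ((u (Suc n) x - u (Suc n) y)\<^sup>2) \<le> sqrt (1 / (t * n))"
    by (rule real_sqrt_le_mono)
  then show "\<bar>u (Suc n) x - u (Suc n) y\<bar> \<le> 1 / sqrt (t * n)"
    by (simp add: real_sqrt_divide)
qed

lemma resolvent_sequence_gradient_sum:
  assumes Ric: "Ric_ge V E 0" and t: "t > 0"
    and u: "\<And>n x. x \<in> V \<Longrightarrow> u (Suc n) x - t * laplacian E (u (Suc n)) x = u n x"
    and u0: "\<And>x. x \<in> V \<Longrightarrow> (u 0 x)\<^sup>2 \<le> 1"
    and e: "{x, y} \<in> E"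
  shows "(\<Sum>k\<le>n. \<bar>u (Suc k) x - u (Suc k) y\<bar>) \<le> 2 + 2 * sqrt n / sqrt t"
proof (induction n)
  case 0
  then show ?case using resolvent_sequence_gradient(1)[OF assms] by simp
next
  case (Suc n)
  have "\<bar>u (Suc (Suc n)) x - u (Suc (Suc n)) y\<bar> \<le> 1 / sqrt (t * Suc n)"
    by (rule resolvent_sequence_gradient(2)[OF assms zero_less_Suc])
  also have "\<dots> = (1 / sqrt (Suc n)) / sqrt t" by (simp add: real_sqrt_mult)
  also have "\<dots> \<le> (2 * (sqrt (Suc n) - sqrt n)) / sqrt t"
    using t by (intro divide_right_mono inverse_sqrt_le) auto
  finally have "\<bar>u (Suc (Suc n)) x - u (Suc (Suc n)) y\<bar> \<le> \<dots>" .
  with Suc show ?case by (simp add: diff_divide_distrib right_diff_distrib)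
qed

section \<open>Flux through the edge boundary\<close>

text \<open>Every boundary edge has exactly one orientation leading out of \<open>A\<close>.\<close>

lemma card_edge_boundary:
  assumes "A \<subseteq> V"
  shows "card (edge_boundary V E A) = card (SIGMA x:A. {y. {x, y} \<in> E \<and> y \<notin> A})"
proof -
  let ?S = "SIGMA x:A. {y. {x, y} \<in> E \<and> y \<notin> A}"
  have "inj_on (\<lambda>(x, y). {x, y}) ?S" by (auto simp: inj_on_def doubleton_eq_iff)
  moreover have "(\<lambda>(x, y). {x, y}) ` ?S = edge_boundary V E A"
    unfolding edge_boundary_def using edge_vertices(2) by (fastforce simp: image_iff)
  ultimately show ?thesis using card_image[of "\<lambda>(x, y). {x, y}" ?S] by simp
qed

text \<open>A discrete divergence theorem: \<open>u y - u x\<close> is antisymmetric, so edges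
  inside \<open>A\<close> contribute nothing.\<close>

lemma sum_laplacian_on_subset:
  assumes "A \<subseteq> V"
  shows "(\<Sum>x\<in>A. laplacian E u x) = (\<Sum>(x, y)\<in>(SIGMA x:A. {y. {x, y} \<in> E \<and> y \<notin> A}). u y - u x)"
proof -
  have finA: "finite A" using assms finite_V by (rule finite_subset)
  have fin: "finite {y. {x, y} \<in> E \<and> y \<notin> A}" for x
    by (rule finite_subset[OF _ finite_neighbours[of x]]) auto
  have split: "laplacian E u x = (\<Sum>y\<in>{y\<in>A. {x, y} \<in> E}. u y - u x)
      + (\<Sum>y | {x, y} \<in> E \<and> y \<notin> A. u y - u x)" for x
    unfolding laplacian_def using finA fin
    by (subst sum.union_disjoint[symmetric]) (auto intro!: sum.cong)
  have "(\<Sum>x\<in>A. \<Sum>y\<in>{y\<in>A. {x, y} \<in> E}. u y - u x) = - (\<Sum>x\<in>A. \<Sum>y\<in>{y\<in>A. {x, y} \<in> E}. u y - u x)"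
    using sum_edges_swap[OF assms, of "\<lambda>x y. u y - u x"]
    by (simp add: sum_negf[symmetric])
  then have "(\<Sum>x\<in>A. \<Sum>y\<in>{y\<in>A. {x, y} \<in> E}. u y - u x) = 0" by simp
  then show ?thesis
    using finA fin by (simp add: split sum.distrib sum.Sigma)
qed

section \<open>Variational description of the spectral gap\<close>

text \<open>Vanishing off \<open>V\<close> makes this set compact in the product topology on all
  functions of the ambient type.\<close>

definition mean_zero_sphere :: "('a \<Rightarrow> real) set" where
  "mean_zero_sphere = {f. (\<forall>x. x \<notin> V \<longrightarrow> f x = 0) \<and> (\<Sum>x\<in>V. f x) = 0 \<and> (\<Sum>x\<in>V. (f x)\<^sup>2) = 1}"

text \<open>By Tychonoff the box \<open>?B\<close> is compact; the two sum conditions are closed,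
  and the norm condition forces values into [-1, 1].\<close>

lemma compact_mean_zero_sphere: "compact mean_zero_sphere"
proof -
  let ?B = "PiE UNIV (\<lambda>x. if x \<in> V then {-1..1::real} else {0})"
  have cont: "continuous_on UNIV (\<lambda>f :: 'a \<Rightarrow> real. f x)" for x
    by (rule continuous_on_product_coordinates)
  have "compactin (product_topology (\<lambda>_. euclidean) UNIV) ?B"
    unfolding compactin_PiE by (auto split: if_splits)
  then have "compact ?B" by (simp add: euclidean_product_topology)
  moreover have "closed {f :: 'a \<Rightarrow> real. (\<Sum>x\<in>V. f x) = 0}"
    by (intro closed_Collect_eq continuous_intros cont)
  moreover have "closed {f :: 'a \<Rightarrow> real. (\<Sum>x\<in>V. (f x)\<^sup>2) = 1}"
    by (intro closed_Collect_eq continuous_intros cont)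
  ultimately have "compact (?B \<inter> ({f. (\<Sum>x\<in>V. f x) = 0} \<inter> {f. (\<Sum>x\<in>V. (f x)\<^sup>2) = 1}))"
    by (intro compact_Int_closed closed_Int)
  moreover have "\<bar>f x\<bar> \<le> 1" if "(\<Sum>x\<in>V. (f x)\<^sup>2) = 1" "x \<in> V" for f :: "'a \<Rightarrow> real" and x
    using member_le_sum[OF that(2), of "\<lambda>x. (f x)\<^sup>2"] that(1) finite_V
    by (simp add: abs_square_le_1)
  then have "mean_zero_sphere = ?B \<inter> ({f. (\<Sum>x\<in>V. f x) = 0} \<inter> {f. (\<Sum>x\<in>V. (f x)\<^sup>2) = 1})"
    unfolding mean_zero_sphere_def by (fastforce simp: PiE_iff abs_le_iff split: if_splits)
  ultimately show ?thesis by simp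
qed

definition dirichlet_energy :: "('a \<Rightarrow> real) \<Rightarrow> real" where
  "dirichlet_energy f = - (\<Sum>x\<in>V. f x * laplacian E f x)"

lemma dirichlet_energy_eq:
  "dirichlet_energy f = 1 / 2 * (\<Sum>x\<in>V. \<Sum>y | {x, y} \<in> E. (f x - f y)\<^sup>2)"
  unfolding dirichlet_energy_def green_formula by (simp add: power2_eq_square)

lemma dirichlet_energy_nonneg: "dirichlet_energy f \<ge> 0"
  unfolding dirichlet_energy_eq by (simp add: sum_nonneg)

lemma normalize_mean_zero:
  assumes "(\<Sum>x\<in>V. f x) = 0" and s: "(\<Sum>x\<in>V. (f x)\<^sup>2) = s" "s > 0"
  shows "(\<lambda>x. if x \<in> V then f x / sqrt s else 0) \<in> mean_zero_sphere" (is "?g \<in> _")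
    and "dirichlet_energy (\<lambda>x. if x \<in> V then f x / sqrt s else 0) = dirichlet_energy f / s"
proof -
  show "?g \<in> mean_zero_sphere"
    using assms unfolding mean_zero_sphere_def
    by (simp add: sum_divide_distrib[symmetric] power_divide cong: sum.cong)
  have "laplacian E ?g x = laplacian E f x / sqrt s" if "x \<in> V" for x
  proof -
    have "laplacian E ?g x = laplacian E (\<lambda>y. (1 / sqrt s) * f y + 0) x"
      using that by (intro laplacian_cong) auto
    then show ?thesis by (simp only: laplacian_affine) simp
  qed
  then have "(\<Sum>x\<in>V. ?g x * laplacian E ?g x) = (\<Sum>x\<in>V. f x * laplacian E f x / s)"
    using s(2) by (intro sum.cong) auto
  then show "dirichlet_energy ?g = dirichlet_energy f / s"
    by (simp add: dirichlet_energy_def sum_divide_distrib)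
qed

text \<open>A continuous function attains its infimum on a compact set; scaling extends the
  inequality beyond the sphere.\<close>

lemma rayleigh_minimizer_exists:
  assumes "card V \<ge> 2"
  obtains \<phi> where "\<phi> \<in> mean_zero_sphere"
    "\<And>f. (\<Sum>x\<in>V. f x) = 0 \<Longrightarrow> dirichlet_energy \<phi> * (\<Sum>x\<in>V. (f x)\<^sup>2) \<le> dirichlet_energy f"
proof -
  obtain a b where ab: "a \<in> V" "b \<in> V" "a \<noteq> b"
    using assms card_le_Suc0_iff_eq[OF finite_V] by fastforce
  define f0 :: "'a \<Rightarrow> real" where "f0 = (\<lambda>x. (if x = a then 1 else 0) - (if x = b then 1 else 0))"
  have "(\<Sum>x\<in>V. f0 x) = 0"
    using ab finite_V by (simp add: f0_def sum_subtractf)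
  moreover have "(\<Sum>x\<in>V. (f0 x)\<^sup>2) > 0"
    using ab finite_V by (intro sum_pos2[of V a]) (auto simp: f0_def)
  ultimately have nonempty: "mean_zero_sphere \<noteq> {}"
    using normalize_mean_zero(1) by blast
  have "continuous_on UNIV dirichlet_energy"
    unfolding dirichlet_energy_def laplacian_def
    by (intro continuous_intros continuous_on_product_coordinates)
  then have "continuous_on mean_zero_sphere dirichlet_energy"
    by (rule continuous_on_subset) simp
  then obtain \<phi> where \<phi>: "\<phi> \<in> mean_zero_sphere"
    "\<And>g. g \<in> mean_zero_sphere \<Longrightarrow> dirichlet_energy \<phi> \<le> dirichlet_energy g"
    using continuous_attains_inf[OF compact_mean_zero_sphere nonempty] by blast
  show ?thesis
  proof (rule that[OF \<phi>(1)])
    fix f :: "'a \<Rightarrow> real" assume f: "(\<Sum>x\<in>V. f x) = 0"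
    let ?s = "\<Sum>x\<in>V. (f x)\<^sup>2"
    have "?s \<ge> 0" by (simp add: sum_nonneg)
    then consider "?s = 0" | "?s > 0" by linarith
    then show "dirichlet_energy \<phi> * ?s \<le> dirichlet_energy f"
    proof cases
      case 1
      then show ?thesis by (simp add: dirichlet_energy_nonneg)
    next
      case 2
      then have "dirichlet_energy \<phi> \<le> dirichlet_energy f / ?s"
        using \<phi>(2)[OF normalize_mean_zero(1)[OF f refl 2]]
          normalize_mean_zero(2)[OF f refl 2] by simp
      then show ?thesis using 2 by (simp add: pos_le_divide_eq)
    qed
  qed
qed

text \<open>First variation: perturb \<open>\<phi>\<close> in the direction of the residual
  \<open>r\<close>, which has mean zero. Minimality gives a quadratic inequality in \<open>c\<close>
  whose linear coefficient is twice the squared norm \<open>b\<close> of \<open>r\<close>, so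
  \<open>b\<close> vanishes.\<close>

lemma rayleigh_minimizer_eigenfunction:
  assumes \<phi>: "\<phi> \<in> mean_zero_sphere"
    and min: "\<And>f. (\<Sum>x\<in>V. f x) = 0 \<Longrightarrow> dirichlet_energy \<phi> * (\<Sum>x\<in>V. (f x)\<^sup>2) \<le> dirichlet_energy f"
    and "x \<in> V"
  shows "- laplacian E \<phi> x = dirichlet_energy \<phi> * \<phi> x"
proof -
  define \<mu> where "\<mu> = dirichlet_energy \<phi>"
  define r where "r = (\<lambda>x. - laplacian E \<phi> x - \<mu> * \<phi> x)"
  define b where "b = (\<Sum>x\<in>V. (r x)\<^sup>2)"
  define q where "q = dirichlet_energy r - \<mu> * b"
  have \<phi>0: "(\<Sum>x\<in>V. \<phi> x) = 0" and \<phi>1: "(\<Sum>x\<in>V. (\<phi> x)\<^sup>2) = 1"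
    using \<phi> by (auto simp: mean_zero_sphere_def)
  have r0: "(\<Sum>x\<in>V. r x) = 0"
    by (simp add: r_def sum_subtractf sum_negf sum_laplacian \<phi>0 sum_distrib_left[symmetric])
  have b_eq: "b = - (\<Sum>x\<in>V. r x * laplacian E \<phi> x) - \<mu> * (\<Sum>x\<in>V. \<phi> x * r x)"
    unfolding b_def sum_distrib_left sum_negf[symmetric] sum_subtractf[symmetric]
    by (intro sum.cong refl) (simp add: r_def power2_eq_square algebra_simps)
  have quadratic: "0 \<le> 2 * c * b + c\<^sup>2 * q" for c
  proof -
    let ?f = "\<lambda>x. \<phi> x + c * r x"
    have "laplacian E ?f x = laplacian E \<phi> x + c * laplacian E r x" for x
      by (rule laplacian_add_scaled)
    then have "dirichlet_energy ?f = - (\<Sum>x\<in>V. \<phi> x * laplacian E \<phi> x + c * (\<phi> x * laplacian E r x)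
        + c * (r x * laplacian E \<phi> x) + c\<^sup>2 * (r x * laplacian E r x))"
      unfolding dirichlet_energy_def by (simp add: power2_eq_square algebra_simps)
    also have "\<dots> = \<mu> - 2 * c * (\<Sum>x\<in>V. r x * laplacian E \<phi> x) + c\<^sup>2 * dirichlet_energy r"
      using laplacian_symmetric[of \<phi> r]
      by (simp add: \<mu>_def dirichlet_energy_def sum.distrib sum_distrib_left[symmetric])
    finally have energy: "dirichlet_energy ?f = \<dots>" .
    have "(\<Sum>x\<in>V. (?f x)\<^sup>2) = (\<Sum>x\<in>V. (\<phi> x)\<^sup>2 + 2 * c * (\<phi> x * r x) + c\<^sup>2 * (r x)\<^sup>2)"
      by (intro sum.cong refl) (simp add: power2_eq_square algebra_simps)
    also have "\<dots> = 1 + 2 * c * (\<Sum>x\<in>V. \<phi> x * r x) + c\<^sup>2 * b"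
      by (simp add: sum.distrib sum_distrib_left[symmetric] \<phi>1 b_def)
    finally have norm: "(\<Sum>x\<in>V. (?f x)\<^sup>2) = \<dots>" .
    have "(\<Sum>x\<in>V. ?f x) = 0"
      by (simp add: sum.distrib sum_distrib_left[symmetric] \<phi>0 r0)
    from min[OF this] show ?thesis
      unfolding energy norm \<mu>_def[symmetric] q_def by (subst b_eq) (simp add: algebra_simps)
  qed
  have "b = 0"
  proof (rule ccontr)
    assume "b \<noteq> 0"
    \<comment> \<open>\<open>c = - b / k\<close> turns the quadratic into
      \<open>(b / k)\<^sup>2 * (q - 2 * k)\<close>, negative because \<open>k\<close> is positive
      and exceeds \<open>q\<close>.\<close>
    define k where "k = \<bar>q\<bar> + 1"
    have k: "k > 0" "q - 2 * k < 0" by (auto simp: k_def)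
    have "0 \<le> 2 * (- b / k) * b + (- b / k)\<^sup>2 * q" by (rule quadratic)
    also have "\<dots> = (b / k)\<^sup>2 * (q - 2 * k)"
      using k(1) by (simp add: power2_eq_square field_simps)
    also have "\<dots> < 0"
      using \<open>b \<noteq> 0\<close> k by (intro mult_pos_neg) auto
    finally show False by simp
  qed
  then have "r x = 0"
    using \<open>x \<in> V\<close> finite_V by (simp add: b_def sum_nonneg_eq_0_iff)
  then show ?thesis by (simp add: r_def \<mu>_def)
qed

text \<open>Zero energy makes \<open>\<phi>\<close> constant along edges, hence on \<open>V\<close>;
  mean zero and norm one then conflict.\<close>

lemma dirichlet_energy_pos:
  assumes "connected_graph V E" and \<phi>: "\<phi> \<in> mean_zero_sphere"
  shows "dirichlet_energy \<phi> > 0"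
proof (rule ccontr)
  assume "\<not> dirichlet_energy \<phi> > 0"
  then have "(\<Sum>x\<in>V. \<Sum>y | {x, y} \<in> E. (\<phi> x - \<phi> y)\<^sup>2) = 0"
    using dirichlet_energy_nonneg[of \<phi>] by (simp add: dirichlet_energy_eq)
  then have edge: "\<phi> x = \<phi> y" if "{x, y} \<in> E" for x y
    using that edge_vertices(1) finite_V finite_neighbours
    by (auto simp: sum_nonneg_eq_0_iff sum_nonneg)
  have path: "\<phi> x = \<phi> y" if "(x, y) \<in> {(u, v). {u, v} \<in> E}\<^sup>*" for x y
    using that by (induction rule: rtrancl_induct) (auto dest: edge)
  obtain a where "a \<in> V" using assms(1) by (auto simp: connected_graph_def)
  with assms(1) have const: "\<phi> x = \<phi> a" if "x \<in> V" for x
    using that path unfolding connected_graph_def by blast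
  have "(\<Sum>x\<in>V. \<phi> x) = real (card V) * \<phi> a"
    using const by simp
  moreover have "(\<Sum>x\<in>V. \<phi> x) = 0" "(\<Sum>x\<in>V. (\<phi> x)\<^sup>2) = 1"
    using \<phi> by (auto simp: mean_zero_sphere_def)
  moreover have "card V > 0" using finite_V \<open>a \<in> V\<close> by (auto simp: card_gt_0_iff)
  ultimately have "\<phi> a = 0" by simp
  then have "(\<Sum>x\<in>V. (\<phi> x)\<^sup>2) = 0" using const by simp
  with \<open>(\<Sum>x\<in>V. (\<phi> x)\<^sup>2) = 1\<close> show False by simp
qed

text \<open>The minimal energy is an eigenvalue. Conversely, an eigenfunction for \<nu> \<noteq> 0
  has mean zero because Laplacians sum to zero, so \<nu> is a Rayleigh quotient and cannot be
  smaller.\<close>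

lemma spectral_gap_poincare:
  assumes "connected_graph V E" "card V \<ge> 2"
  shows "spectral_gap V E > 0"
    and "(\<Sum>x\<in>V. f x) = 0 \<Longrightarrow> spectral_gap V E * (\<Sum>x\<in>V. (f x)\<^sup>2) \<le> dirichlet_energy f"
proof -
  obtain \<phi> where \<phi>: "\<phi> \<in> mean_zero_sphere"
    and min: "\<And>f. (\<Sum>x\<in>V. f x) = 0 \<Longrightarrow> dirichlet_energy \<phi> * (\<Sum>x\<in>V. (f x)\<^sup>2) \<le> dirichlet_energy f"
    using rayleigh_minimizer_exists[OF assms(2)] by metis
  have pos: "dirichlet_energy \<phi> > 0" by (rule dirichlet_energy_pos[OF assms(1) \<phi>])
  have "\<exists>x\<in>V. \<phi> x \<noteq> 0"
  proof (rule ccontr)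
    assume "\<not> (\<exists>x\<in>V. \<phi> x \<noteq> 0)"
    then have "(\<Sum>x\<in>V. (\<phi> x)\<^sup>2) = 0" by simp
    with \<phi> show False by (simp add: mean_zero_sphere_def)
  qed
  with rayleigh_minimizer_eigenfunction[OF \<phi> min]
  have eigenvalue: "neg_laplacian_eigenvalue V E (dirichlet_energy \<phi>)"
    unfolding neg_laplacian_eigenvalue_def by blast
  have least: "dirichlet_energy \<phi> \<le> \<nu>" if eig: "neg_laplacian_eigenvalue V E \<nu>" and "\<nu> \<noteq> 0" for \<nu>
  proof -
    obtain g where "\<exists>x\<in>V. g x \<noteq> 0" and "\<forall>x\<in>V. - laplacian E g x = \<nu> * g x"
      using eig unfolding neg_laplacian_eigenvalue_def by blast
    then obtain a where a: "a \<in> V" "g a \<noteq> 0"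
      and g: "\<And>x. x \<in> V \<Longrightarrow> - laplacian E g x = \<nu> * g x"
      by blast
    have "\<nu> * (\<Sum>x\<in>V. g x) = (\<Sum>x\<in>V. - laplacian E g x)"
      using g by (simp add: sum_distrib_left)
    then have "(\<Sum>x\<in>V. g x) = 0" using \<open>\<nu> \<noteq> 0\<close> by (simp add: sum_negf sum_laplacian)
    from min[OF this] have "dirichlet_energy \<phi> * (\<Sum>x\<in>V. (g x)\<^sup>2) \<le> (\<Sum>x\<in>V. g x * - laplacian E g x)"
      by (simp add: dirichlet_energy_def sum_negf)
    also have "\<dots> = \<nu> * (\<Sum>x\<in>V. (g x)\<^sup>2)"
      unfolding sum_distrib_left by (intro sum.cong refl) (simp add: g power2_eq_square)
    finally show ?thesis
      using sum_pos2[OF finite_V a(1), of "\<lambda>x. (g x)\<^sup>2"] a(2) by simp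
  qed
  have "spectral_gap V E = dirichlet_energy \<phi>"
    unfolding spectral_gap_def using eigenvalue pos least by (intro Least_equality) auto
  then show "spectral_gap V E > 0"
    and "(\<Sum>x\<in>V. f x) = 0 \<Longrightarrow> spectral_gap V E * (\<Sum>x\<in>V. (f x)\<^sup>2) \<le> dirichlet_energy f"
    using pos min by simp_all
qed

section \<open>Mean, self-adjointness and decay of the Euler steps\<close>

lemma resolvent_sequence_mean:
  assumes u: "\<And>n x. x \<in> V \<Longrightarrow> u (Suc n) x - t * laplacian E (u (Suc n)) x = u n x"
  shows "(\<Sum>x\<in>V. u n x) = (\<Sum>x\<in>V. u 0 x)"
proof (induction n)
  case (Suc n)
  have "(\<Sum>x\<in>V. u n x) = (\<Sum>x\<in>V. u (Suc n) x - t * laplacian E (u (Suc n)) x)"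
    using u by simp
  also have "\<dots> = (\<Sum>x\<in>V. u (Suc n) x)"
    by (simp add: sum_subtractf sum_distrib_left[symmetric] sum_laplacian)
  finally show ?case using Suc by simp
qed simp

text \<open>The resolvent is self-adjoint, so steps move from one factor to the other. With
  \<open>i = 0\<close> and \<open>j = k\<close> the pairing becomes a squared norm.\<close>

lemma resolvent_sequence_shift:
  assumes u: "\<And>n x. x \<in> V \<Longrightarrow> u (Suc n) x - t * laplacian E (u (Suc n)) x = u n x"
  shows "(\<Sum>x\<in>V. u i x * u (j + k) x) = (\<Sum>x\<in>V. u (i + k) x * u j x)"
proof (induction k arbitrary: i)
  case (Suc k)
  have "(\<Sum>x\<in>V. u i x * u (j + Suc k) x) =
      (\<Sum>x\<in>V. u (Suc i) x * u (Suc (j + k)) x - t * (u (Suc (j + k)) x * laplacian E (u (Suc i)) x))"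
    by (intro sum.cong refl) (simp add: u[of _ i, symmetric] algebra_simps)
  also have "\<dots> =
      (\<Sum>x\<in>V. u (Suc i) x * u (Suc (j + k)) x - t * (u (Suc i) x * laplacian E (u (Suc (j + k))) x))"
    unfolding sum_subtractf sum_distrib_left[symmetric] by (subst laplacian_symmetric) simp
  also have "\<dots> = (\<Sum>x\<in>V. u (Suc i) x * u (j + k) x)"
    by (intro sum.cong refl) (simp add: u[of _ "j + k", symmetric] algebra_simps)
  also have "\<dots> = (\<Sum>x\<in>V. u (Suc i + k) x * u j x)" by (rule Suc)
  finally show ?case by simp
qed simp

text \<open>Expand the norm of \<open>v - t \<Delta> v\<close>, drop the square of the Laplacian and
  apply the Poincare inequality, available since the mean stays zero.\<close>

lemma resolvent_sequence_decay:
  assumes "connected_graph V E" "card V \<ge> 2" and t: "t \<ge> 0"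
    and u: "\<And>n x. x \<in> V \<Longrightarrow> u (Suc n) x - t * laplacian E (u (Suc n)) x = u n x"
    and u0: "(\<Sum>x\<in>V. u 0 x) = 0"
  shows "(1 + 2 * t * spectral_gap V E) ^ n * (\<Sum>x\<in>V. (u n x)\<^sup>2) \<le> (\<Sum>x\<in>V. (u 0 x)\<^sup>2)"
proof (induction n)
  case (Suc n)
  let ?c = "1 + 2 * t * spectral_gap V E" and ?v = "u (Suc n)"
  have c: "?c \<ge> 0" using spectral_gap_poincare(1)[OF assms(1,2)] t by simp
  have "(\<Sum>x\<in>V. (u n x)\<^sup>2) = (\<Sum>x\<in>V. (?v x)\<^sup>2 - 2 * t * (?v x * laplacian E ?v x) + t\<^sup>2 * (laplacian E ?v x)\<^sup>2)"
    by (intro sum.cong refl) (simp add: u[of _ n, symmetric] power2_eq_square algebra_simps)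
  also have "\<dots> = (\<Sum>x\<in>V. (?v x)\<^sup>2) + 2 * t * dirichlet_energy ?v + t\<^sup>2 * (\<Sum>x\<in>V. (laplacian E ?v x)\<^sup>2)"
    by (simp add: dirichlet_energy_def sum.distrib sum_subtractf sum_distrib_left[symmetric])
  also have "\<dots> \<ge> (\<Sum>x\<in>V. (?v x)\<^sup>2) + 2 * t * (spectral_gap V E * (\<Sum>x\<in>V. (?v x)\<^sup>2)) + 0"
    using spectral_gap_poincare(2)[OF assms(1,2), of ?v] resolvent_sequence_mean[of u t, OF u] u0 t
    by (intro add_mono mult_left_mono mult_nonneg_nonneg sum_nonneg) auto
  finally have "?c * (\<Sum>x\<in>V. (?v x)\<^sup>2) \<le> (\<Sum>x\<in>V. (u n x)\<^sup>2)" by (simp add: algebra_simps)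
  then have "?c ^ n * (?c * (\<Sum>x\<in>V. (?v x)\<^sup>2)) \<le> ?c ^ n * (\<Sum>x\<in>V. (u n x)\<^sup>2)"
    using c by (intro mult_left_mono) auto
  also note Suc
  finally show ?case by (simp add: mult.assoc mult.left_commute)
qed simp

section \<open>Lower bound for the edge boundary\<close>

text \<open>Each step changes the sum over \<open>A\<close> by a flux through its boundary, so every
  boundary edge carries \<open>t\<close> times its accumulated gradient.\<close>

lemma resolvent_sequence_boundary_bound:
  assumes Ric: "Ric_ge V E 0" and t: "t > 0"
    and u: "\<And>n x. x \<in> V \<Longrightarrow> u (Suc n) x - t * laplacian E (u (Suc n)) x = u n x"
    and u0: "\<And>x. x \<in> V \<Longrightarrow> \<bar>2 * u 0 x + c\<bar> \<le> 1"
    and A: "A \<subseteq> V"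
  shows "(\<Sum>x\<in>A. u 0 x - u (Suc n) x) \<le> card (edge_boundary V E A) * (t + sqrt t * sqrt (Suc n))"
proof -
  let ?S = "SIGMA x:A. {y. {x, y} \<in> E \<and> y \<notin> A}"
  \<comment> \<open>Data with values in an interval of length 1 are stretched to [-1, 1]; the
    recursion is preserved and the gradient bound for \<open>u\<close> is halved.\<close>
  define v where "v = (\<lambda>k x. 2 * u k x + c)"
  have v: "v (Suc k) x - t * laplacian E (v (Suc k)) x = v k x" if "x \<in> V" for k x
    unfolding v_def laplacian_affine using u[OF that, of k] by (simp add: algebra_simps)
  have v0: "(v 0 x)\<^sup>2 \<le> 1" if "x \<in> V" for x
    using u0[OF that] by (simp add: v_def abs_square_le_1)
  have grad: "(\<Sum>k\<le>n. u (Suc k) x - u (Suc k) y) \<le> 1 + sqrt (Suc n) / sqrt t" if "{x, y} \<in> E" for x y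
  proof -
    have "2 * (\<Sum>k\<le>n. u (Suc k) x - u (Suc k) y) \<le> (\<Sum>k\<le>n. \<bar>v (Suc k) x - v (Suc k) y\<bar>)"
      unfolding sum_distrib_left by (intro sum_mono) (simp add: v_def)
    also have "\<dots> \<le> 2 + 2 * sqrt n / sqrt t"
      by (rule resolvent_sequence_gradient_sum[OF Ric t v v0 that])
    also have "\<dots> \<le> 2 + 2 * sqrt (Suc n) / sqrt t"
      using t by (intro add_left_mono divide_right_mono) auto
    finally show ?thesis by simp
  qed
  have "(\<Sum>x\<in>A. u 0 x - u (Suc n) x) = (\<Sum>x\<in>A. \<Sum>k\<le>n. u k x - u (Suc k) x)"
    by (intro sum.cong refl) (rule sum_telescope[of "\<lambda>k. u k _", symmetric])
  also have "\<dots> = (\<Sum>x\<in>A. \<Sum>k\<le>n. - t * laplacian E (u (Suc k)) x)"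
    using A u[symmetric] by (intro sum.cong) (auto simp: algebra_simps subset_iff)
  also have "\<dots> = (\<Sum>k\<le>n. - t * (\<Sum>x\<in>A. laplacian E (u (Suc k)) x))"
    by (subst sum.swap) (simp only: sum_distrib_left)
  also have "\<dots> = (\<Sum>k\<le>n. \<Sum>(x, y)\<in>?S. t * (u (Suc k) x - u (Suc k) y))"
    unfolding sum_laplacian_on_subset[OF A] sum_distrib_left
    by (intro sum.cong refl) (auto simp: algebra_simps)
  also have "\<dots> = (\<Sum>(x, y)\<in>?S. t * (\<Sum>k\<le>n. u (Suc k) x - u (Suc k) y))"
    by (subst sum.swap) (simp add: sum_distrib_left case_prod_beta)
  also have "\<dots> \<le> (\<Sum>p\<in>?S. t * (1 + sqrt (Suc n) / sqrt t))"
    using grad t by (intro sum_mono) (auto simp del: of_nat_Suc)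
  also have "\<dots> = card (edge_boundary V E A) * (t * (1 + sqrt (Suc n) / sqrt t))"
    by (simp add: card_edge_boundary[OF A])
  also have "t * (1 + sqrt (Suc n) / sqrt t) = t + sqrt t * sqrt (Suc n)"
    using t real_sqrt_mult_self[of t] by (simp add: field_simps del: of_nat_Suc)
  finally show ?thesis .
qed

lemma boundary_lower_bound_step:
  assumes conn: "connected_graph V E" and cV: "card V \<ge> 2" and Ric: "Ric_ge V E 0"
    and A: "A \<subseteq> V" "real (card A) \<le> real (card V) / 2"
  shows "card A / 4 \<le> card (edge_boundary V E A) *
    (1 / (2 * spectral_gap V E * real (Suc m)) + 1 / sqrt (spectral_gap V E))"
proof -
  define l where "l = spectral_gap V E"
  \<comment> \<open>Chosen so that \<open>2 * t * l * Suc m = 1\<close>: this halves the norm and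
    makes \<open>t * N = 1 / l\<close> below.\<close>
  define t where "t = 1 / (2 * l * real (Suc m))"
  define a where "a = real (card A) / real (card V)"
  define f :: "'a \<Rightarrow> real" where "f = (\<lambda>x. indicator A x - a)"
  have l: "l > 0" unfolding l_def by (rule spectral_gap_poincare(1)[OF conn cV])
  then have t: "t > 0" by (simp add: t_def)
  have a: "0 \<le> a" "a \<le> 1 / 2" and aV: "a * card V = card A"
    using A(2) cV by (simp_all add: a_def field_simps)
  have sum_ind: "(\<Sum>x\<in>V. indicator A x) = real (card A)"
    using A(1) finite_V by (simp add: indicator_def sum.If_cases Int_absorb1)
  obtain u where u0: "u 0 = f"
    and u: "\<And>n x. x \<in> V \<Longrightarrow> u (Suc n) x - t * laplacian E (u (Suc n)) x = u n x"
    using resolvent_sequence_exists[of t f] t by (metis less_imp_le)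
  have f_mean: "(\<Sum>x\<in>V. f x) = 0"
    using aV sum_ind by (simp add: f_def sum_subtractf mult.commute)
  then have mean: "(\<Sum>x\<in>V. u n x) = 0" for n
    using resolvent_sequence_mean[of u t n, OF u] u0 by simp
  have "(\<Sum>x\<in>V. (f x)\<^sup>2) = (\<Sum>x\<in>V. (1 - 2 * a) * indicator A x + a\<^sup>2)"
    by (intro sum.cong refl) (auto simp: f_def indicator_def power2_eq_square algebra_simps)
  also have "\<dots> = (1 - 2 * a) * card A + a * (a * card V)"
    by (simp add: sum.distrib sum_distrib_left[symmetric] sum_ind power2_eq_square)
  also have "\<dots> = card A * (1 - a)" by (simp only: aV) (simp add: algebra_simps)
  also have "\<dots> \<ge> card A * (1 / 2)" using a by (intro mult_left_mono) auto
  finally have norm_f: "card A / 2 \<le> (\<Sum>x\<in>V. (f x)\<^sup>2)" by simp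
  \<comment> \<open>Bernoulli: after \<open>Suc m\<close> steps the squared norm has at least halved.\<close>
  have "2 \<le> 1 + real (Suc m) * (2 * t * l)"
    using l by (simp add: t_def del: of_nat_Suc)
  also have "\<dots> \<le> (1 + 2 * t * l) ^ Suc m"
    using t l by (intro Bernoulli_inequality) (simp add: less_imp_le order_trans[of "-1" 0])
  finally have "2 * (\<Sum>x\<in>V. (u (Suc m) x)\<^sup>2) \<le> (1 + 2 * t * l) ^ Suc m * (\<Sum>x\<in>V. (u (Suc m) x)\<^sup>2)"
    by (intro mult_right_mono sum_nonneg) auto
  also have "\<dots> \<le> (\<Sum>x\<in>V. (f x)\<^sup>2)"
    using resolvent_sequence_decay[of t u "Suc m", OF conn cV _ u] t f_mean u0
    unfolding l_def by simp
  finally have decay: "2 * (\<Sum>x\<in>V. (u (Suc m) x)\<^sup>2) \<le> (\<Sum>x\<in>V. (f x)\<^sup>2)" .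
  \<comment> \<open>An even number of steps, so that the pairing of \<open>u 0\<close> with
    \<open>u N\<close> is the squared norm at the midpoint.\<close>
  define N where "N = Suc m + Suc m"
  have "(\<Sum>x\<in>A. u 0 x - u N x) = (\<Sum>x\<in>V. indicator A x * (f x - u N x))"
    using A(1) finite_V u0
    by (simp add: indicator_def sum.If_cases Int_absorb1 if_distrib[where f="\<lambda>c. c * _"] cong: if_cong)
  \<comment> \<open>The indicator of \<open>A\<close> is \<open>f + a\<close>, and the constant
    \<open>a\<close> pairs to zero with functions of mean zero.\<close>
  also have "\<dots> = (\<Sum>x\<in>V. (f x)\<^sup>2 - f x * u N x + (a * f x - a * u N x))"
    by (intro sum.cong refl) (simp add: f_def power2_eq_square algebra_simps)
  also have "\<dots> = (\<Sum>x\<in>V. (f x)\<^sup>2) - (\<Sum>x\<in>V. u 0 x * u (Suc m + Suc m) x)"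
    by (simp add: sum.distrib sum_subtractf sum_distrib_left[symmetric] mean f_mean u0 N_def)
  also have "(\<Sum>x\<in>V. u 0 x * u (Suc m + Suc m) x) = (\<Sum>x\<in>V. (u (Suc m) x)\<^sup>2)"
    using resolvent_sequence_shift[of u t 0 "Suc m" "Suc m", OF u] by (simp add: power2_eq_square)
  finally have "card A / 4 \<le> (\<Sum>x\<in>A. u 0 x - u N x)"
    using decay norm_f by simp
  also have "\<dots> \<le> card (edge_boundary V E A) * (t + sqrt t * sqrt N)"
  proof -
    \<comment> \<open>The left side is the absolute value of twice the indicator minus 1, that is,
      of 1 or -1.\<close>
    have "\<bar>2 * u 0 x + (2 * a - 1)\<bar> \<le> 1" for x
      by (auto simp: u0 f_def indicator_def)
    from resolvent_sequence_boundary_bound[of t u "2 * a - 1" A "m + Suc m", OF Ric t u this A(1)]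
    show ?thesis by (simp add: N_def)
  qed
  also have "sqrt t * sqrt N = 1 / sqrt l"
  proof -
    have "real N = 2 * real (Suc m)" by (simp add: N_def)
    then have "t * N = 1 / l" using l by (simp add: t_def del: of_nat_Suc)
    then show ?thesis by (simp only: real_sqrt_mult[symmetric] real_sqrt_divide real_sqrt_one)
  qed
  finally show ?thesis unfolding t_def l_def .
qed

text \<open>Refining the step size sends the error term, which is \<open>t\<close> itself, to
  zero.\<close>

lemma boundary_lower_bound:
  assumes "connected_graph V E" "card V \<ge> 2" "Ric_ge V E 0"
    and "A \<subseteq> V" "real (card A) \<le> real (card V) / 2"
  shows "card A / 4 \<le> card (edge_boundary V E A) / sqrt (spectral_gap V E)"
proof -
  let ?l = "spectral_gap V E" and ?d = "real (card (edge_boundary V E A))"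
  have "(\<lambda>m. ?d * (1 / (2 * ?l) * inverse (real (Suc m)) + 1 / sqrt ?l))
      \<longlonglongrightarrow> ?d * (1 / (2 * ?l) * 0 + 1 / sqrt ?l)"
    by (intro tendsto_intros LIMSEQ_inverse_real_of_nat)
  then have "card A / 4 \<le> ?d * (1 / (2 * ?l) * 0 + 1 / sqrt ?l)"
  proof (rule LIMSEQ_le_const, intro exI allI impI)
    fix m
    have "1 / (2 * ?l * real (Suc m)) = 1 / (2 * ?l) * inverse (real (Suc m))"
      by (simp only: divide_inverse inverse_mult_distrib mult_1_left)
    with boundary_lower_bound_step[OF assms, of m]
    show "card A / 4 \<le> ?d * (1 / (2 * ?l) * inverse (real (Suc m)) + 1 / sqrt ?l)"
      by (simp only:)
  qed
  then show ?thesis by simp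
qed

end

theorem theorem1:
  fixes V :: "'a set" and E :: "'a set set"
  assumes "finite V"
    and "simple_graph V E"
    and "no_isolated_vertices V E"
    and "connected_graph V E"
    and "Ric_ge V E 0"
  shows "spectral_gap V E \<le> 16 * (cheeger_constant V E)\<^sup>2"
proof -
  interpret finite_simple_graph V E by unfold_locales (fact assms)+
  obtain a where "a \<in> V" using assms(4) by (auto simp: connected_graph_def)
  then obtain b where ab: "{a, b} \<in> E" using assms(3) by (auto simp: no_isolated_vertices_def)
  have cV: "card V \<ge> 2"
    using card_mono[OF finite_V, of "{a, b}"] edge_vertices[OF ab] by simp
  let ?C = "{A. A \<subseteq> V \<and> 0 < card A \<and> real (card A) \<le> real (card V) / 2}"
  \<comment> \<open>A singleton is admissible because there are two vertices, so the minimum is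
    attained by some \<open>A\<close>.\<close>
  have "{a} \<in> ?C" using \<open>a \<in> V\<close> cV by simp
  moreover have "finite ?C" using finite_V by simp
  ultimately have "cheeger_constant V E \<in>
      (\<lambda>A. real (card (edge_boundary V E A)) / real (card A)) ` ?C"
    unfolding cheeger_constant_def by (intro Min_in) auto
  then obtain A where A: "A \<subseteq> V" "0 < card A" "real (card A) \<le> real (card V) / 2"
    and h: "cheeger_constant V E = card (edge_boundary V E A) / card A"
    by auto
  have l: "spectral_gap V E > 0" by (rule spectral_gap_poincare(1)[OF assms(4) cV])
  have "card A / 4 \<le> card (edge_boundary V E A) / sqrt (spectral_gap V E)"
    by (rule boundary_lower_bound[OF assms(4) cV assms(5) A(1,3)])
  then have "sqrt (spectral_gap V E) \<le> 4 * cheeger_constant V E"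
    using l A(2) by (simp add: h field_simps)
  then have "(sqrt (spectral_gap V E))\<^sup>2 \<le> (4 * cheeger_constant V E)\<^sup>2"
    using l by (intro power_mono) auto
  then show ?thesis using l by (simp add: power_mult_distrib)
qed

end
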